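(* Let $\mathcal{Q}$ be an optimum achieving (OA) quantization scheme for the quantized primal-dual algorithm. Then $$\liminf_{k\to\infty}\frac1k\log \mathsf{E}\left[\|\boldsymbol{\epsilon}_k\|_2^2\right]\ \ge\ \frac{2}{N+M}\left(\sum_{i=1}^M\log\left(1+\mu^\star\frac{d^2U_i}{d(x^i)^2}\left({x^i}^\star\right)\right)-R_{\mathcal{Q}}\right),$$ where $\boldsymbol{\epsilon}_k=\boldsymbol{y}_k-\boldsymbol{y}^\star$ and ${x^i}^\star$ is the optimal value of the primal variable $x^i$.
   Context: **Problem.** Let $N<M$ be positive integers, $A\in\mathbb{R}^{N\times M}$, $\boldsymbol{b}\in\mathbb{R}^N$, $U_i:\mathbb{R}\to\mathbb{R}$ ($1\le i\le M$). Consider: maximize $\sum_{i=1}^M U_i(x^i)$ over $\boldsymbol{x}=[x^1,\dots,x^M]^\top$ subject to $A\boldsymbol{x}=\boldsymbol{b}$. Let $\boldsymbol{x}^\star,\boldsymbol{\lambda}^\star$ be the optimal primal and dual solutions, and $\boldsymbol{y}^\star$ their concatenation. $A_i$ is the $i$th column of $A$, $\bar A_j$ its $j$th row. **Quantization scheme.** At time $k\ge 0$, agent $i$ encodes $x^i_k$ into a symbol $\hat Q^{\boldsymbol{x}}_{i,k}=E^{\boldsymbol{x}}_{i,k}(\{x^i_n\}_{n=0}^k,\{\hat Q^{\boldsymbol{x}}_{i,n}\}_{n=0}^{k-1})$ in a finite alphabet $\mathcal{A}^{\boldsymbol{x}}_{i,k}$, and the quantized value is reconstructed as $Q^{\boldsymbol{x}}_{i,k}=D^{\boldsymbol{x}}_{i,k}(\{\hat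 Q^{\boldsymbol{x}}_{i,n}\}_{n=0}^k)$. Likewise, network node $j$ ($1\le j\le N$) encodes $\lambda^j_k$ into $\hat Q^{\boldsymbol{\lambda}}_{j,k}=E^{\boldsymbol{\lambda}}_{j,k}(\{\lambda^j_n\}_{n=0}^k,\{\hat Q^{\boldsymbol{\lambda}}_{j,n}\}_{n=0}^{k-1})$ in a finite alphabet $\mathcal{A}^{\boldsymbol{\lambda}}_{j,k}$, with reconstruction $Q^{\boldsymbol{\lambda}}_{j,k}=D^{\boldsymbol{\lambda}}_{j,k}(\{\hat Q^{\boldsymbol{\lambda}}_{j,n}\}_{n=0}^k)$. The collection $\mathcal{Q}$ of all these encoder and decoder maps is a quantization scheme. Write $Q^{\boldsymbol{x}}_k=[Q^{\boldsymbol{x}}_{1,k},\dots,Q^{\boldsymbol{x}}_{M,k}]^\top$, $Q^{\boldsymbol{\lambda}}_k=[Q^{\boldsymbol{\lambda}}_{1,k},\dots,Q^{\boldsymbol{\lambda}}_{N,k}]^\top$. **Quantized primal-dual (PD) algorithm.** For $k\ge1$, $$x^i_k=x^i_{k-1}+\mu_{k-1}\left(U_i'(x^i_{k-1})-A_i^\top Q^{\boldsymbol{\lambda}}_{k-1}\right),\qquad \lambda^j_k=\lambda^j_{k-1}+\mu_{k-1}\left(\bar A_jQ^{\boldsymbol{x}}_{k-1}-b_j\right).$$ $\boldsymbol{y}_k$ is the concatenation of $\boldsymbol{x}_k$ and $\boldsymbol{\lambda}_k$. The initial vectors $\boldsymbol{x}_0,\boldsymbol{\lambda}_0$ are random with densities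 $p_{\boldsymbol{x}_0},p_{\boldsymbol{\lambda}_0}$. **Standing assumptions.** (1) Each $U_i$ is concave and twice continuously differentiable. (2) There are constants with $U_i^{\min}\le U_i''(x)\le U_i^{\max}<0$ for all $x\in\mathbb{R}$ and all $i$. (3) $0<\mu_k<\min_i 1/|U_i^{\min}|$ for all $k$. (4) $\mu_k\to\mu^\star>0$. (5) $\boldsymbol{x}_0$ and $\boldsymbol{\lambda}_0$ are independent and have finite differential entropies ($\mathsf{h}[\boldsymbol{z}]=-\int p_{\boldsymbol{z}}\log p_{\boldsymbol{z}}$). **OA scheme.** $\mathcal{Q}$ is optimum achieving (OA) if under $\mathcal{Q}$, $\lim_k\boldsymbol{x}_k=\boldsymbol{x}^\star$ and $\lim_k\boldsymbol{\lambda}_k=\boldsymbol{\lambda}^\star$, for any initial vectors in the supports of their densities. **Data rate.** $R_{\mathcal{Q}}=\lim_{k\to\infty}\frac1k\sum_{t=0}^{k-1}\left(\sum_{i=1}^M\log|\mathcal{A}^{\boldsymbol{x}}_{i,t}|+\sum_{j=1}^N\log|\mathcal{A}^{\boldsymbol{\lambda}}_{j,t}|\right)$ (limit assumed to exist). Logarithms are natural, with $\log 0=-\infty$. *)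

theory Defs
  imports "HOL-Probability.Probability"
begin

subsection \<open>The optimization problem\<close>

definition objective :: "('m::finite \<Rightarrow> real \<Rightarrow> real) \<Rightarrow> real^'m \<Rightarrow> real" where
  "objective U x = (\<Sum>i\<in>UNIV. U i (x $ i))"

definition lagrangian ::
  "('m::finite \<Rightarrow> real \<Rightarrow> real) \<Rightarrow> real^'m^'n::finite \<Rightarrow> real^'n \<Rightarrow> real^'m \<Rightarrow> real^'n \<Rightarrow> real" where
  "lagrangian U A b x l = objective U x - l \<bullet> (A *v x - b)"

definition dual_function ::
  "('m::finite \<Rightarrow> real \<Rightarrow> real) \<Rightarrow> real^'m^'n::finite \<Rightarrow> real^'n \<Rightarrow> real^'n \<Rightarrow> ereal" where
  "dual_function U A b l = (SUP x. ereal (lagrangian U A b x l))"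

definition primal_optimal ::
  "('m::finite \<Rightarrow> real \<Rightarrow> real) \<Rightarrow> real^'m^'n::finite \<Rightarrow> real^'n \<Rightarrow> real^'m \<Rightarrow> bool" where
  "primal_optimal U A b x \<longleftrightarrow> is_arg_max (objective U) (\<lambda>x. A *v x = b) x"

definition dual_optimal ::
  "('m::finite \<Rightarrow> real \<Rightarrow> real) \<Rightarrow> real^'m^'n::finite \<Rightarrow> real^'n \<Rightarrow> real^'n \<Rightarrow> bool" where
  "dual_optimal U A b l \<longleftrightarrow> is_arg_min (dual_function U A b) (\<lambda>_. True) l"

definition twice_continuously_differentiable :: "(real \<Rightarrow> real) \<Rightarrow> bool" where
  "twice_continuously_differentiable f \<longleftrightarrow>
     (\<forall>x. f field_differentiable at x) \<and>
     (\<forall>x. deriv f field_differentiable at x) \<and>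
     continuous_on UNIV (deriv (deriv f))"

subsection \<open>Quantization schemes\<close>

text \<open>
  A coder holds, for each node \<open>i\<close> and time \<open>k\<close>, an alphabet, an encoder and a decoder.
  Histories are lists, oldest entry first: at time \<open>k\<close> the encoder receives the \<open>k + 1\<close>
  values up to time \<open>k\<close> and the \<open>k\<close> earlier symbols, the decoder the \<open>k + 1\<close> symbols
  up to time \<open>k\<close>.
\<close>

record ('i, 's) coder =
  alphabet :: "'i \<Rightarrow> nat \<Rightarrow> 's set"
  encoder :: "'i \<Rightarrow> nat \<Rightarrow> real list \<Rightarrow> 's list \<Rightarrow> 's"
  decoder :: "'i \<Rightarrow> nat \<Rightarrow> 's list \<Rightarrow> real"

definition valid_coder :: "('i, 's) coder \<Rightarrow> bool" where
  "valid_coder C \<longleftrightarrow>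
     (\<forall>i k. finite (alphabet C i k)) \<and>
     (\<forall>i k zs ss. length zs = Suc k \<and> length ss = k \<and> (\<forall>n<k. ss ! n \<in> alphabet C i n)
        \<longrightarrow> encoder C i k zs ss \<in> alphabet C i k)"

text \<open>\<open>symbols C i z k\<close> lists the symbols that node \<open>i\<close> emits at the times \<open>0, \<dots>, k - 1\<close>.\<close>

primrec symbols :: "('i, 's) coder \<Rightarrow> 'i \<Rightarrow> (nat \<Rightarrow> real) \<Rightarrow> nat \<Rightarrow> 's list" where
  "symbols C i z 0 = []"
| "symbols C i z (Suc k) =
     symbols C i z k @ [encoder C i k (map z [0..<Suc k]) (symbols C i z k)]"

definition quantized :: "('i::finite, 's) coder \<Rightarrow> (nat \<Rightarrow> real^'i) \<Rightarrow> nat \<Rightarrow> real^'i" where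
  "quantized C z k = (\<chi> i. decoder C i k (symbols C i (\<lambda>n. z n $ i) (Suc k)))"

record ('m, 'n, 's, 't) quantization_scheme =
  primal_coder :: "('m, 's) coder"
  dual_coder :: "('n, 't) coder"

definition valid_scheme :: "('m, 'n, 's, 't) quantization_scheme \<Rightarrow> bool" where
  "valid_scheme Q \<longleftrightarrow> valid_coder (primal_coder Q) \<and> valid_coder (dual_coder Q)"

definition average_rate ::
  "('m::finite, 'n::finite, 's, 't) quantization_scheme \<Rightarrow> nat \<Rightarrow> real" where
  "average_rate Q k = 1 / real k * (\<Sum>t<k.
     (\<Sum>i\<in>UNIV. ln (real (card (alphabet (primal_coder Q) i t)))) +
     (\<Sum>j\<in>UNIV. ln (real (card (alphabet (dual_coder Q) j t)))))"

text \<open>Meaningful only if the limit exists; an infinite rate is allowed.\<close>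

definition data_rate :: "('m::finite, 'n::finite, 's, 't) quantization_scheme \<Rightarrow> ereal" where
  "data_rate Q = lim (\<lambda>k. ereal (average_rate Q k))"

subsection \<open>The quantized primal-dual algorithm\<close>

text \<open>
  The sequences \<open>x\<close> and \<open>l\<close> are the primal and dual iterates. The right-hand sides depend
  only on the iterates up to time \<open>k\<close>, so each pair of initial vectors has exactly one run.
\<close>

definition pd_run ::
  "('m::finite \<Rightarrow> real \<Rightarrow> real) \<Rightarrow> real^'m^'n::finite \<Rightarrow> real^'n \<Rightarrow> (nat \<Rightarrow> real) \<Rightarrow>
   ('m, 'n, 's, 't) quantization_scheme \<Rightarrow> (nat \<Rightarrow> real^'m) \<Rightarrow> (nat \<Rightarrow> real^'n) \<Rightarrow> bool" where
  "pd_run U A b \<mu> Q x l \<longleftrightarrow> (\<forall>k.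
     (\<forall>i. x (Suc k) $ i =
        x k $ i + \<mu> k * (deriv (U i) (x k $ i) - column i A \<bullet> quantized (dual_coder Q) l k)) \<and>
     (\<forall>j. l (Suc k) $ j =
        l k $ j + \<mu> k * (row j A \<bullet> quantized (primal_coder Q) x k - b $ j)))"

text \<open>
  The support of a density is the set where it is nonzero, without closure. Convergence is
  thus required from fewer initial vectors than with the closed support.
\<close>

definition optimum_achieving ::
  "('m::finite \<Rightarrow> real \<Rightarrow> real) \<Rightarrow> real^'m^'n::finite \<Rightarrow> real^'n \<Rightarrow> (nat \<Rightarrow> real) \<Rightarrow>
   (real^'m \<Rightarrow> real) \<Rightarrow> (real^'n \<Rightarrow> real) \<Rightarrow> real^'m \<Rightarrow> real^'n \<Rightarrow>
   ('m, 'n, 's, 't) quantization_scheme \<Rightarrow> bool" where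
  "optimum_achieving U A b \<mu> px pl xs ls Q \<longleftrightarrow>
     (\<forall>x l. pd_run U A b \<mu> Q x l \<and> x 0 \<in> support_on UNIV px \<and> l 0 \<in> support_on UNIV pl
        \<longrightarrow> x \<longlonglongrightarrow> xs \<and> l \<longlonglongrightarrow> ls)"

subsection \<open>Probabilistic notions\<close>

text \<open>
  \<open>indep_var\<close> of the library requires both variables to have the same type; this is the
  same condition (cf. \<open>indep_var_eq\<close>) without that restriction.
\<close>

definition independent_vars ::
  "'w measure \<Rightarrow> ('w \<Rightarrow> 'a::topological_space) \<Rightarrow> ('w \<Rightarrow> 'b::topological_space) \<Rightarrow> bool" where
  "independent_vars M X Y \<longleftrightarrow>
     X \<in> borel_measurable M \<and> Y \<in> borel_measurable M \<and>
     prob_space.indep_set M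
       {X -` S \<inter> space M | S. S \<in> sets borel} {Y -` S \<inter> space M | S. S \<in> sets borel}"

subsection \<open>Extended logarithm\<close>

text \<open>The value at negative arguments is irrelevant.\<close>

definition eln :: "ereal \<Rightarrow> ereal" where
  "eln r = (if r = \<infinity> then \<infinity> else if r \<le> 0 then - \<infinity> else ereal (ln (real_of_ereal r)))"

end

theory Submission
  imports Defs
begin

text \<open>
  The proof is a volume count. Fix the symbols that all nodes emit before time \<open>k\<close>. Along runs
  with these symbols the quantized values are constants, so the difference of two dual iterates
  never changes, and each primal coordinate evolves under increasing maps of slope
  \<open>1 + \<mu> t * U''\<close> (lemmas \<open>dual_runs_translate\<close> and \<open>primal_runs_expand\<close>). As the iterates converge
  to the optimum, the slopes approach \<open>1 + \<mu>s * U''(xs)\<close>, and the maps from initial to current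
  vectors compress volume at time \<open>k\<close> by a factor of about \<open>\<Prod>i. (1 + \<mu>s * U''(xs $ i)) ^ k\<close> and no
  more. The initial vectors with one given symbol history that end within distance \<open>r\<close> of the
  optimum therefore fill a volume of at most order \<open>r ^ (N + M)\<close> divided by this factor, where
  \<open>N + M\<close> is the total dimension. There are at most \<open>exp (k * R)\<close> histories up to a subexponential
  factor, with \<open>R\<close> the data rate (\<open>card_symbol_profiles\<close>). Unless
  \<open>r ^ (N + M)\<close> is at least of the order \<open>exp (- k * R) * (\<Prod>i. (1 + \<mu>s * U''(xs $ i)) ^ k)\<close>, these
  vectors cannot carry a fixed fraction of the probability (\<open>prob_le_card_cells\<close>), so that the
  error exceeds such an \<open>r\<close> with probability bounded away from zero and the mean square error is
  at least of order \<open>r\<^sup>2\<close> (\<open>mean_square_error_ge\<close>).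

  Two points make this rigorous. First, the densities may be unbounded and the convergence may be
  slow, but only on a set of probability at most one half
  (\<open>eventually_prob_bounded_and_close\<close>), which can be left out because a positive fraction of
  outcomes far from the optimum is enough. Second, the slopes are only close to their limits; a
  loss factor \<open>exp (- \<delta>)\<close> in each coordinate accounts for this, and \<open>\<delta>\<close> tends to zero at the end.
\<close>

section \<open>Counting symbol strings\<close>

lemma length_symbols [simp]: "length (symbols C i z k) = k"
  by (induction k) auto

lemma take_symbols: "t \<le> k \<Longrightarrow> take t (symbols C i z k) = symbols C i z t"
proof (induction k)
  case (Suc k)
  show ?case
  proof (cases "t = Suc k")
    case True
    then show ?thesis by (metis length_symbols order_refl take_all)
  next
    case False
    with Suc show ?thesis by simp
  qed
qed simp

text \<open>
  Decoders see only symbols, so nodes that have emitted the same string before time \<open>k\<close> are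
  reconstructed identically at all earlier times, however the encoders produced the string.
\<close>

lemma quantized_eq_if_symbols_eq:
  assumes "\<And>i. symbols C i (\<lambda>n. z n $ i) k = symbols C i (\<lambda>n. z' n $ i) k" and "t < k"
  shows "quantized C z t = quantized C z' t"
proof -
  have "symbols C i (\<lambda>n. z n $ i) (Suc t) = symbols C i (\<lambda>n. z' n $ i) (Suc t)" for i
    using assms take_symbols[of "Suc t" k C i] by (metis Suc_leI)
  then show ?thesis by (simp add: quantized_def del: symbols.simps)
qed

text \<open>
  Strings that respect the alphabets, whether or not some iterate produces them. This
  over-approximation has a product structure, hence a cardinality given by the alphabets alone.
\<close>

definition symbol_strings :: "('i, 's) coder \<Rightarrow> 'i \<Rightarrow> nat \<Rightarrow> 's list set" where
  "symbol_strings C i k = {ss. length ss = k \<and> (\<forall>n<k. ss ! n \<in> alphabet C i n)}"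

lemma symbol_strings_Suc:
  "symbol_strings C i (Suc k) = (\<lambda>(ss, s). ss @ [s]) ` (symbol_strings C i k \<times> alphabet C i k)"
proof (intro equalityI subsetI)
  fix us assume us: "us \<in> symbol_strings C i (Suc k)"
  then obtain ss s where "us = ss @ [s]" "length ss = k"
    by (auto simp: symbol_strings_def length_Suc_conv_rev)
  moreover from this us have "\<forall>n<k. ss ! n \<in> alphabet C i n" "s \<in> alphabet C i k"
    by (auto simp: symbol_strings_def nth_append less_Suc_eq split: if_splits)
  ultimately show "us \<in> (\<lambda>(ss, s). ss @ [s]) ` (symbol_strings C i k \<times> alphabet C i k)"
    by (auto simp: symbol_strings_def)
qed (auto simp: symbol_strings_def nth_append less_Suc_eq)

lemma
  assumes "valid_coder C"
  shows finite_symbol_strings: "finite (symbol_strings C i k)"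
    and card_symbol_strings: "card (symbol_strings C i k) = (\<Prod>t<k. card (alphabet C i t))"
proof -
  have "finite (symbol_strings C i k) \<and>
      card (symbol_strings C i k) = (\<Prod>t<k. card (alphabet C i t))"
  proof (induction k)
    case 0
    show ?case by (simp add: symbol_strings_def)
  next
    case (Suc k)
    moreover have "finite (alphabet C i k)"
      using assms by (auto simp: valid_coder_def)
    moreover have "inj_on (\<lambda>(ss, s). ss @ [s]) (symbol_strings C i k \<times> alphabet C i k)"
      by (auto simp: inj_on_def)
    ultimately show ?case
      by (simp add: symbol_strings_Suc card_image card_cartesian_product)
  qed
  then show "finite (symbol_strings C i k)"
    and "card (symbol_strings C i k) = (\<Prod>t<k. card (alphabet C i t))" by auto
qed

lemma symbols_in_symbol_strings:
  assumes "valid_coder C"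
  shows "symbols C i z k \<in> symbol_strings C i k"
proof (induction k)
  case 0
  show ?case by (simp add: symbol_strings_def)
next
  case (Suc k)
  have "encoder C i k zs ss \<in> alphabet C i k"
    if "length zs = Suc k" "length ss = k" "\<forall>n<k. ss ! n \<in> alphabet C i n" for zs ss
    using assms that unfolding valid_coder_def by blast
  from this[of "map z [0..<Suc k]" "symbols C i z k"]
  have "encoder C i k (map z [0..<Suc k]) (symbols C i z k) \<in> alphabet C i k"
    using Suc by (simp add: symbol_strings_def del: upt_Suc)
  with Suc show ?case by (auto simp: symbol_strings_Suc simp del: upt_Suc)
qed

text \<open>
  Validity forces nonempty alphabets, because some symbol is emitted at each time. This keeps
  the logarithms in the rate nonnegative and rules out the default value of \<open>ln 0\<close>.
\<close>

lemma card_alphabet_pos: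
  assumes "valid_coder C"
  shows "0 < card (alphabet C i k)"
proof -
  have "alphabet C i k \<noteq> {}"
    using symbols_in_symbol_strings[OF assms, of i "\<lambda>_. 0" "Suc k"]
    by (auto simp: symbol_strings_def)
  moreover have "finite (alphabet C i k)"
    using assms by (auto simp: valid_coder_def)
  ultimately show ?thesis by (simp add: card_gt_0_iff)
qed

definition run_symbols ::
  "('m, 'n, 's, 't) quantization_scheme \<Rightarrow> nat \<Rightarrow> (nat \<Rightarrow> real^'m) \<Rightarrow> (nat \<Rightarrow> real^'n) \<Rightarrow>
   ('m \<Rightarrow> 's list) \<times> ('n \<Rightarrow> 't list)" where
  "run_symbols Q k x l =
     (\<lambda>i. symbols (primal_coder Q) i (\<lambda>n. x n $ i) k,
      \<lambda>j. symbols (dual_coder Q) j (\<lambda>n. l n $ j) k)"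

definition symbol_profiles ::
  "('m::finite, 'n::finite, 's, 't) quantization_scheme \<Rightarrow> nat \<Rightarrow>
   (('m \<Rightarrow> 's list) \<times> ('n \<Rightarrow> 't list)) set" where
  "symbol_profiles Q k =
     (\<Pi>\<^sub>E i\<in>UNIV. symbol_strings (primal_coder Q) i k) \<times>
     (\<Pi>\<^sub>E j\<in>UNIV. symbol_strings (dual_coder Q) j k)"

lemma run_symbols_in_profiles:
  "valid_scheme Q \<Longrightarrow> run_symbols Q k x l \<in> symbol_profiles Q k"
  by (auto simp: run_symbols_def symbol_profiles_def valid_scheme_def symbols_in_symbol_strings)

lemma finite_symbol_profiles: "valid_scheme Q \<Longrightarrow> finite (symbol_profiles Q k)"
  unfolding symbol_profiles_def valid_scheme_def
  by (intro finite_cartesian_product finite_PiE) (auto simp: finite_symbol_strings)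

text \<open>
  The data rate enters the proof only here: it is the exponential growth rate of the number of
  possible symbol histories, which bounds the number of cells of initial vectors.
\<close>

lemma card_symbol_profiles:
  fixes Q :: "('m::finite, 'n::finite, 's, 't) quantization_scheme"
  assumes "valid_scheme Q"
  shows "real (card (symbol_profiles Q k)) = exp (real k * average_rate Q k)"
proof -
  have valid: "valid_coder (primal_coder Q)" "valid_coder (dual_coder Q)"
    using assms by (auto simp: valid_scheme_def)
  note pos = card_alphabet_pos[OF valid(1)] card_alphabet_pos[OF valid(2)]
  have "real k * average_rate Q k =
      (\<Sum>t<k. \<Sum>i\<in>UNIV. ln (real (card (alphabet (primal_coder Q) i t)))) +
      (\<Sum>t<k. \<Sum>j\<in>UNIV. ln (real (card (alphabet (dual_coder Q) j t))))"
    by (cases "k = 0") (simp_all add: average_rate_def sum.distrib)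
  then have "exp (real k * average_rate Q k) =
      (\<Prod>t<k. \<Prod>i\<in>UNIV. real (card (alphabet (primal_coder Q) i t))) *
      (\<Prod>t<k. \<Prod>j\<in>UNIV. real (card (alphabet (dual_coder Q) j t)))"
    using pos by (simp add: exp_add exp_sum)
  also have "\<dots> =
      (\<Prod>i\<in>UNIV. \<Prod>t<k. real (card (alphabet (primal_coder Q) i t))) *
      (\<Prod>j\<in>UNIV. \<Prod>t<k. real (card (alphabet (dual_coder Q) j t)))"
    by (intro arg_cong2[where f = "(*)"] prod.swap)
  also have "\<dots> = real (card (symbol_profiles Q k))"
    by (simp add: symbol_profiles_def card_cartesian_product card_PiE
        card_symbol_strings[OF valid(1)] card_symbol_strings[OF valid(2)])
  finally show ?thesis ..
qed

lemma average_rate_nonneg: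
  assumes "valid_scheme Q"
  shows "0 \<le> average_rate Q k"
proof -
  have "1 \<le> card (alphabet (primal_coder Q) i t)" "1 \<le> card (alphabet (dual_coder Q) j t)" for i j t
    using assms card_alphabet_pos by (auto simp: valid_scheme_def Suc_le_eq)
  then show ?thesis
    unfolding average_rate_def by (intro mult_nonneg_nonneg sum_nonneg add_nonneg_nonneg) simp_all
qed

section \<open>Runs with equal symbols\<close>

text \<open>
  The primal step \<open>z + m U'(z)\<close> has derivative \<open>1 + m U''(z)\<close>, so by the mean value theorem it
  cannot shrink a distance by more than the least slope on the way. Convexity of \<open>S\<close> keeps the
  intermediate point where the slope is controlled.
\<close>

lemma gradient_step_expands:
  assumes C2: "twice_continuously_differentiable f"
    and "convex S" "x \<in> S" "y \<in> S"
    and slope: "\<And>z. z \<in> S \<Longrightarrow> c \<le> 1 + m * deriv (deriv f) z"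
  shows "c * \<bar>x - y\<bar> \<le> \<bar>(x + m * deriv f x) - (y + m * deriv f y)\<bar>"
proof -
  define g where "g z = z + m * deriv f z" for z
  have g': "(g has_real_derivative 1 + m * deriv (deriv f) z) (at z)" for z
    using C2 unfolding g_def twice_continuously_differentiable_def
    by (auto intro!: derivative_eq_intros simp: DERIV_deriv_iff_field_differentiable)
  have *: "c * (v - u) \<le> g v - g u" if "u < v" "u \<in> S" "v \<in> S" for u v
  proof -
    obtain z where z: "u < z" "z < v" "g v - g u = (v - u) * (1 + m * deriv (deriv f) z)"
      using MVT2[OF \<open>u < v\<close>, of g "\<lambda>z. 1 + m * deriv (deriv f) z"] g' by blast
    have "z \<in> S"
      using \<open>convex S\<close> that z convex_contains_segment[of S]
      by (force simp: closed_segment_eq_real_ivl)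
    then show ?thesis
      using slope[of z] \<open>u < v\<close> z(3) by (simp add: mult.commute mult_left_mono)
  qed
  consider "x < y" | "x = y" | "y < x" by linarith
  then have "c * \<bar>x - y\<bar> \<le> \<bar>g x - g y\<bar>"
    by cases (use *[of x y] *[of y x] assms(3,4) in auto)
  then show ?thesis by (simp add: g_def)
qed

text \<open>
  For two runs with equal symbols, the quantized dual variables are the same and cancel in the
  difference of the primal iterates. What remains is a scalar recursion in each coordinate, to
  which the slope bound of a single step applies at every time. In place of a Jacobian
  determinant this is all that is needed.
\<close>

lemma primal_runs_expand:
  assumes runs: "pd_run U A b \<mu> Q x l" "pd_run U A b \<mu> Q x' l'"
    and same: "run_symbols Q k x l = run_symbols Q k x' l'"
    and C2: "twice_continuously_differentiable (U i)"
    and S: "\<And>t. t < k \<Longrightarrow> convex (S t) \<and> x t $ i \<in> S t \<and> x' t $ i \<in> S t"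
    and slope: "\<And>t z. t < k \<Longrightarrow> z \<in> S t \<Longrightarrow> c t \<le> 1 + \<mu> t * deriv (deriv (U i)) z"
    and c_nonneg: "\<And>t. 0 \<le> c t"
  shows "(\<Prod>t<k. c t) * \<bar>x 0 $ i - x' 0 $ i\<bar> \<le> \<bar>x k $ i - x' k $ i\<bar>"
proof -
  have "(\<Prod>t<n. c t) * \<bar>x 0 $ i - x' 0 $ i\<bar> \<le> \<bar>x n $ i - x' n $ i\<bar>" if "n \<le> k" for n
    using that
  proof (induction n)
    case (Suc n)
    have "quantized (dual_coder Q) l n = quantized (dual_coder Q) l' n"
      using same Suc.prems
      by (intro quantized_eq_if_symbols_eq[of _ l k l']) (auto simp: run_symbols_def dest: fun_cong)
    then have "x (Suc n) $ i - x' (Suc n) $ i =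
        (x n $ i + \<mu> n * deriv (U i) (x n $ i)) - (x' n $ i + \<mu> n * deriv (U i) (x' n $ i))"
      using runs by (simp add: pd_run_def right_diff_distrib)
    moreover have "c n * \<bar>x n $ i - x' n $ i\<bar> \<le>
        \<bar>(x n $ i + \<mu> n * deriv (U i) (x n $ i)) - (x' n $ i + \<mu> n * deriv (U i) (x' n $ i))\<bar>"
      using S[of n] slope[of n] Suc.prems by (intro gradient_step_expands[OF C2, of "S n"]) auto
    moreover have "(\<Prod>t<Suc n. c t) * \<bar>x 0 $ i - x' 0 $ i\<bar> \<le> c n * \<bar>x n $ i - x' n $ i\<bar>"
      using Suc mult_left_mono[OF _ c_nonneg[of n]] by (fastforce simp: mult.assoc mult.left_commute)
    ultimately show ?case by linarith
  qed simp
  then show ?thesis by simp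
qed

text \<open>
  The dual step adds a quantity that depends on the symbols alone, so it neither expands nor
  contracts; this is why the dual variables contribute only to the dimension in the bound.
\<close>

lemma dual_runs_translate:
  assumes runs: "pd_run U A b \<mu> Q x l" "pd_run U A b \<mu> Q x' l'"
    and same: "run_symbols Q k x l = run_symbols Q k x' l'"
  shows "l k $ j - l' k $ j = l 0 $ j - l' 0 $ j"
proof -
  have "l n $ j - l' n $ j = l 0 $ j - l' 0 $ j" if "n \<le> k" for n
    using that
  proof (induction n)
    case (Suc n)
    have "quantized (primal_coder Q) x n = quantized (primal_coder Q) x' n"
      using same Suc.prems
      by (intro quantized_eq_if_symbols_eq[of _ x k x']) (auto simp: run_symbols_def dest: fun_cong)
    then have "l (Suc n) $ j - l' (Suc n) $ j = l n $ j - l' n $ j"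
      using runs by (simp add: pd_run_def)
    with Suc show ?case by simp
  qed simp
  then show ?thesis by blast
qed

section \<open>Probability of sets with small cells\<close>

lemma prob_box_le:
  fixes V :: "'w \<Rightarrow> real^'d::finite"
  assumes "prob_space M"
    and V: "distributed M lborel V (\<lambda>v. ennreal (p v))"
    and "0 \<le> C" and r: "\<And>i. 0 \<le> r i"
  shows "measure M {\<omega>\<in>space M. p (V \<omega>) \<le> C \<and> (\<forall>i. \<bar>V \<omega> $ i - a $ i\<bar> \<le> r i)} \<le> C * (\<Prod>i\<in>UNIV. 2 * r i)"
proof -
  interpret prob_space M by fact
  define B where "B = cbox (\<chi> i. a $ i - r i) (\<chi> i. a $ i + r i)"
  define S where "S = {v \<in> B. ennreal (p v) \<le> ennreal C}"
  have [measurable]: "(\<lambda>v. ennreal (p v)) \<in> borel_measurable lborel"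
    using V by (rule distributed_borel_measurable)
  have S: "S \<in> sets lborel" unfolding S_def B_def by measurable
  have "B \<noteq> {}"
    using r by (simp add: B_def interval_ne_empty_cart add_increasing2 order_trans[of _ "a $ _" for a])
  then have vol: "measure lborel B = (\<Prod>i\<in>UNIV. 2 * r i)"
    unfolding B_def by (subst content_cbox_cart) auto
  have "emeasure M (V -` S \<inter> space M) = (\<integral>\<^sup>+v. ennreal (p v) * indicator S v \<partial>lborel)"
    by (rule distributed_emeasure[OF V S])
  also have "\<dots> \<le> (\<integral>\<^sup>+v. ennreal C * indicator B v \<partial>lborel)"
    by (intro nn_integral_mono) (auto simp: S_def indicator_def)
  also have "\<dots> = ennreal C * emeasure lborel B"
    by (simp add: nn_integral_cmult_indicator B_def)
  also have "\<dots> = ennreal (C * (\<Prod>i\<in>UNIV. 2 * r i))"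
  proof -
    have "emeasure lborel B \<noteq> \<top>"
      using emeasure_lborel_cbox_finite by (simp add: B_def less_top)
    then have "emeasure lborel B = ennreal (\<Prod>i\<in>UNIV. 2 * r i)"
      by (simp add: emeasure_eq_ennreal_measure vol)
    then show ?thesis
      using \<open>0 \<le> C\<close> r by (simp add: ennreal_mult prod_nonneg)
  qed
  finally have "measure M (V -` S \<inter> space M) \<le> C * (\<Prod>i\<in>UNIV. 2 * r i)"
    using \<open>0 \<le> C\<close> r by (simp add: emeasure_eq_measure prod_nonneg)
  moreover have "V -` S \<inter> space M = {\<omega>\<in>space M. p (V \<omega>) \<le> C \<and> (\<forall>i. \<bar>V \<omega> $ i - a $ i\<bar> \<le> r i)}"
    using \<open>0 \<le> C\<close> by (auto simp: S_def B_def mem_box_cart abs_le_iff ennreal_le_iff algebra_simps)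
  ultimately show ?thesis by simp
qed

text \<open>
  A set of outcomes whose initial vectors are spread over \<open>card P\<close> cells, each of small
  diameter in every coordinate, is improbable as long as the densities are bounded on it. Each
  nonempty cell is covered by a box centred at the initial vectors of one of its outcomes. The
  cells, the level sets of \<open>\<sigma>\<close>, may fail to be measurable since encoders are arbitrary
  functions; the boxes are measurable anyway, and \<open>G\<close> lies in their union. The densities are
  bounded separately and combined by independence, so no joint density appears.
\<close>

lemma prob_le_card_cells:
  fixes X :: "'w \<Rightarrow> real^'m::finite" and L :: "'w \<Rightarrow> real^'n::finite"
  assumes "prob_space M"
    and X: "distributed M lborel X (\<lambda>x. ennreal (px x))" and [measurable]: "px \<in> borel_measurable borel"
    and L: "distributed M lborel L (\<lambda>l. ennreal (pl l))" and [measurable]: "pl \<in> borel_measurable borel"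
    and indep: "independent_vars M X L"
    and C: "0 \<le> C" "\<And>\<omega>. \<omega> \<in> G \<Longrightarrow> px (X \<omega>) \<le> C \<and> pl (L \<omega>) \<le> C"
    and G: "G \<in> sets M"
    and P: "finite P" "\<And>\<omega>. \<omega> \<in> G \<Longrightarrow> \<sigma> \<omega> \<in> P"
    and d: "\<And>i. 0 \<le> d i" "\<And>\<omega> \<omega>' i. \<omega> \<in> G \<Longrightarrow> \<omega>' \<in> G \<Longrightarrow> \<sigma> \<omega> = \<sigma> \<omega>' \<Longrightarrow> \<bar>X \<omega> $ i - X \<omega>' $ i\<bar> \<le> d i"
    and e: "\<And>j. 0 \<le> e j" "\<And>\<omega> \<omega>' j. \<omega> \<in> G \<Longrightarrow> \<omega>' \<in> G \<Longrightarrow> \<sigma> \<omega> = \<sigma> \<omega>' \<Longrightarrow> \<bar>L \<omega> $ j - L \<omega>' $ j\<bar> \<le> e j"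
  shows "measure M G \<le> real (card P) * (C * (\<Prod>i\<in>UNIV. 2 * d i) * (C * (\<Prod>j\<in>UNIV. 2 * e j)))"
proof -
  interpret prob_space M by fact
  have [measurable]: "X \<in> borel_measurable M" "L \<in> borel_measurable M"
    using indep by (auto simp: independent_vars_def)
  define rep where "rep s = (SOME \<omega>. \<omega> \<in> G \<and> \<sigma> \<omega> = s)" for s
  have rep: "rep (\<sigma> \<omega>) \<in> G \<and> \<sigma> (rep (\<sigma> \<omega>)) = \<sigma> \<omega>" if "\<omega> \<in> G" for \<omega>
    unfolding rep_def using that by (intro someI_ex[of "\<lambda>\<omega>'. \<omega>' \<in> G \<and> \<sigma> \<omega>' = \<sigma> \<omega>"]) auto
  define SX where "SX s = {x. px x \<le> C \<and> (\<forall>i. \<bar>x $ i - X (rep s) $ i\<bar> \<le> d i)}" for s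
  define SL where "SL s = {l. pl l \<le> C \<and> (\<forall>j. \<bar>l $ j - L (rep s) $ j\<bar> \<le> e j)}" for s
  have [measurable]: "SX s \<in> sets borel" "SL s \<in> sets borel" for s
    unfolding SX_def SL_def by measurable
  define FX where "FX s = X -` SX s \<inter> space M" for s
  define FL where "FL s = L -` SL s \<inter> space M" for s
  have [measurable]: "FX s \<in> sets M" "FL s \<in> sets M" for s
    unfolding FX_def FL_def by measurable
  have pX: "prob (FX s) \<le> C * (\<Prod>i\<in>UNIV. 2 * d i)" for s
  proof -
    have "FX s = {\<omega>\<in>space M. px (X \<omega>) \<le> C \<and> (\<forall>i. \<bar>X \<omega> $ i - X (rep s) $ i\<bar> \<le> d i)}"
      by (auto simp: FX_def SX_def)
    then show ?thesis
      using prob_box_le[OF \<open>prob_space M\<close> X \<open>0 \<le> C\<close> d(1), of "X (rep s)"] by simp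
  qed
  have pL: "prob (FL s) \<le> C * (\<Prod>j\<in>UNIV. 2 * e j)" for s
  proof -
    have "FL s = {\<omega>\<in>space M. pl (L \<omega>) \<le> C \<and> (\<forall>j. \<bar>L \<omega> $ j - L (rep s) $ j\<bar> \<le> e j)}"
      by (auto simp: FL_def SL_def)
    then show ?thesis
      using prob_box_le[OF \<open>prob_space M\<close> L \<open>0 \<le> C\<close> e(1), of "L (rep s)"] by simp
  qed
  have cell: "prob (FX s \<inter> FL s) \<le> C * (\<Prod>i\<in>UNIV. 2 * d i) * (C * (\<Prod>j\<in>UNIV. 2 * e j))" for s
  proof -
    have "prob (FX s \<inter> FL s) = prob (FX s) * prob (FL s)"
      using indep unfolding independent_vars_def FX_def FL_def
      by (intro indep_setD[where A = "{X -` S \<inter> space M | S. S \<in> sets borel}"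
            and B = "{L -` S \<inter> space M | S. S \<in> sets borel}"]) auto
    then show ?thesis
      using pX[of s] pL[of s] C(1) d(1) by (simp add: mult_mono prod_nonneg)
  qed
  have "G \<subseteq> (\<Union>s\<in>P. FX s \<inter> FL s)"
  proof
    fix \<omega> assume "\<omega> \<in> G"
    then have "\<omega> \<in> FX (\<sigma> \<omega>) \<inter> FL (\<sigma> \<omega>)"
      using C(2) rep d(2)[of \<omega> "rep (\<sigma> \<omega>)"] e(2)[of \<omega> "rep (\<sigma> \<omega>)"] sets.sets_into_space[OF G]
      by (auto simp: FX_def FL_def SX_def SL_def)
    with P(2)[OF \<open>\<omega> \<in> G\<close>] show "\<omega> \<in> (\<Union>s\<in>P. FX s \<inter> FL s)" by blast
  qed
  then have "prob G \<le> prob (\<Union>s\<in>P. FX s \<inter> FL s)"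
    using P(1) by (intro finite_measure_mono) auto
  also have "\<dots> \<le> (\<Sum>s\<in>P. prob (FX s \<inter> FL s))"
    using P(1) by (intro finite_measure_subadditive_finite) auto
  also have "\<dots> \<le> (\<Sum>s\<in>P. C * (\<Prod>i\<in>UNIV. 2 * d i) * (C * (\<Prod>j\<in>UNIV. 2 * e j)))"
    by (intro sum_mono cell)
  finally show ?thesis by simp
qed

lemma AE_density_nonzero:
  assumes "distributed M N X (\<lambda>x. ennreal (p x))" and "\<And>x. 0 \<le> p x"
  shows "AE \<omega> in M. p (X \<omega>) \<noteq> 0"
proof (rule AE_distrD[where P = "\<lambda>x. p x \<noteq> 0"])
  show "X \<in> measurable M N"
    using assms by (simp add: distributed_measurable)
  have "(\<lambda>x. ennreal (p x)) \<in> borel_measurable N"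
    by (rule distributed_borel_measurable[OF assms(1)])
  then show "AE x in distr M N X. p x \<noteq> 0"
    unfolding distributed_distr_eq_density[OF assms(1)] by (subst AE_density) auto
qed

text \<open>
  Pointwise convergence is turned into uniform convergence on a set of large probability, as in
  Egorov's theorem. The bounds on \<open>f\<close> and \<open>g\<close> (later the two densities at the initial vectors)
  come for free from the same monotone limit.
\<close>

lemma eventually_prob_bounded_and_close:
  fixes X :: "nat \<Rightarrow> 'w \<Rightarrow> 'a::{second_countable_topology, real_normed_vector}"
  assumes "prob_space M" and [measurable]: "\<And>t. X t \<in> borel_measurable M"
    "f \<in> borel_measurable M" "g \<in> borel_measurable M"
    and conv: "AE \<omega> in M. (\<lambda>t. X t \<omega>) \<longlonglongrightarrow> a" and "0 < \<eta>" and "q < 1"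
  shows "eventually (\<lambda>n. q \<le> measure M
      {\<omega>\<in>space M. f \<omega> \<le> real n \<and> g \<omega> \<le> real n \<and> (\<forall>t\<ge>n. dist (X t \<omega>) a \<le> \<eta>)}) sequentially"
proof -
  interpret prob_space M by fact
  define G where
    "G n = {\<omega>\<in>space M. f \<omega> \<le> real n \<and> g \<omega> \<le> real n \<and> (\<forall>t\<ge>n. dist (X t \<omega>) a \<le> \<eta>)}" for n
  have [measurable]: "G n \<in> sets M" for n unfolding G_def by measurable
  have "incseq G"
    by (rule incseq_SucI) (auto simp: G_def)
  then have "(\<lambda>n. prob (G n)) \<longlonglongrightarrow> prob (\<Union>n. G n)"
    by (intro finite_Lim_measure_incseq) auto
  moreover have "AE \<omega> in M. \<omega> \<in> (\<Union>n. G n)"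
    using conv AE_space
  proof eventually_elim
    case (elim \<omega>)
    then obtain n1 where n1: "\<And>t. t \<ge> n1 \<Longrightarrow> dist (X t \<omega>) a < \<eta>"
      using \<open>0 < \<eta>\<close> unfolding lim_sequentially by blast
    obtain n2 where "f \<omega> \<le> real n2" using real_arch_simple by blast
    moreover obtain n3 where "g \<omega> \<le> real n3" using real_arch_simple by blast
    ultimately have bounds: "f \<omega> \<le> real (n1 + n2 + n3)" "g \<omega> \<le> real (n1 + n2 + n3)" by simp_all
    have "\<omega> \<in> G (n1 + n2 + n3)"
      using bounds n1 elim(2) by (auto simp: G_def intro: less_imp_le)
    then show ?case by blast
  qed
  then have "prob (\<Union>n. G n) = 1"
    by (subst prob_eq_1) auto
  ultimately have "(\<lambda>n. prob (G n)) \<longlonglongrightarrow> 1" by simp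
  then have "eventually (\<lambda>n. q < prob (G n)) sequentially"
    using \<open>q < 1\<close> by (rule order_tendstoD)
  then show ?thesis
    unfolding G_def by eventually_elim simp
qed

section \<open>Lower bound for the mean square error at a fixed time\<close>

lemma second_moment_ge:
  assumes "prob_space M" and [measurable]: "Z \<in> borel_measurable M" and [measurable]: "G \<in> sets M"
    and G: "1 / 2 \<le> measure M G" and small: "measure M {\<omega>\<in>G. Z \<omega> \<le> r} \<le> 1 / 4" and "0 \<le> r"
  shows "ennreal (r\<^sup>2 / 4) \<le> (\<integral>\<^sup>+\<omega>. ennreal ((Z \<omega>)\<^sup>2) \<partial>M)"
proof -
  interpret prob_space M by fact
  have GM: "G \<subseteq> space M" by (rule sets.sets_into_space) fact
  define H where "H = {\<omega>\<in>G. \<not> Z \<omega> \<le> r}"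
  have "{\<omega>\<in>G. Z \<omega> \<le> r} = G \<inter> {\<omega>\<in>space M. Z \<omega> \<le> r}" "H = G \<inter> {\<omega>\<in>space M. \<not> Z \<omega> \<le> r}"
    using GM by (auto simp: H_def)
  then have [measurable]: "{\<omega>\<in>G. Z \<omega> \<le> r} \<in> sets M" "H \<in> sets M" by simp_all
  have "G = {\<omega>\<in>G. Z \<omega> \<le> r} \<union> H" by (auto simp: H_def)
  then have "prob G \<le> prob {\<omega>\<in>G. Z \<omega> \<le> r} + prob H"
    using measure_Un_le[of "{\<omega>\<in>G. Z \<omega> \<le> r}" M H] by simp
  then have "1 / 4 \<le> prob H" using G small by simp
  then have "r\<^sup>2 / 4 \<le> r\<^sup>2 * prob H"
    using mult_left_mono[of "1/4" "prob H" "r\<^sup>2"] by simp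
  then have "ennreal (r\<^sup>2 / 4) \<le> ennreal (r\<^sup>2) * emeasure M H"
    by (simp add: emeasure_eq_measure flip: ennreal_mult)
  also have "\<dots> = (\<integral>\<^sup>+\<omega>. ennreal (r\<^sup>2) * indicator H \<omega> \<partial>M)"
    by (simp add: nn_integral_cmult_indicator)
  also have "\<dots> \<le> (\<integral>\<^sup>+\<omega>. ennreal ((Z \<omega>)\<^sup>2) \<partial>M)"
    using \<open>0 \<le> r\<close> by (intro nn_integral_mono) (auto simp: H_def indicator_def intro!: ennreal_leI power_mono)
  finally show ?thesis .
qed

text \<open>
  Consider the outcomes in \<open>G\<close> with error at most \<open>r\<close> at time \<open>k\<close>. Two of them with equal
  symbols have iterates at distance at most \<open>2 r\<close> in each coordinate, hence initial vectors at
  distance at most \<open>2 r / J i\<close> (primal) and \<open>2 r\<close> (dual), where \<open>J i\<close> is the product of the slopes.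
  Counting cells gives the probability bound
  \<open>exp (k * average_rate Q k) * C\<^sup>2 * (4 * r) ^ (CARD('n) + CARD('m)) / (\<Prod>i. J i)\<close>.
  The radius is chosen to make this equal to \<open>1 / 4\<close>, which leaves probability at least \<open>1 / 4\<close>
  for errors above \<open>r\<close> inside \<open>G\<close>.
\<close>

lemma mean_square_error_ge:
  fixes A :: "real^'m::finite^'n::finite" and b :: "real^'n"
    and Q :: "('m, 'n, 's, 't) quantization_scheme"
    and X :: "nat \<Rightarrow> 'w \<Rightarrow> real^'m" and L :: "nat \<Rightarrow> 'w \<Rightarrow> real^'n"
    and S :: "nat \<Rightarrow> 'm \<Rightarrow> real set"
  assumes prob: "prob_space M"
    and [measurable]: "\<And>k. X k \<in> borel_measurable M" "\<And>k. L k \<in> borel_measurable M"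
    and px: "distributed M lborel (X 0) (\<lambda>x. ennreal (px x))" "px \<in> borel_measurable borel"
    and pl: "distributed M lborel (L 0) (\<lambda>l. ennreal (pl l))" "pl \<in> borel_measurable borel"
    and indep: "independent_vars M (X 0) (L 0)"
    and scheme: "valid_scheme Q"
    and run: "\<And>\<omega>. \<omega> \<in> space M \<Longrightarrow> pd_run U A b \<mu> Q (\<lambda>k. X k \<omega>) (\<lambda>k. L k \<omega>)"
    and C2: "\<And>i. twice_continuously_differentiable (U i)"
    and [measurable]: "G \<in> sets M" and half: "1 / 2 \<le> measure M G"
    and C: "0 < C" "\<And>\<omega>. \<omega> \<in> G \<Longrightarrow> px (X 0 \<omega>) \<le> C \<and> pl (L 0 \<omega>) \<le> C"
    and S: "\<And>\<omega> t i. \<omega> \<in> G \<Longrightarrow> X t \<omega> $ i \<in> S t i" "\<And>t i. convex (S t i)"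
    and slope: "\<And>t i z. z \<in> S t i \<Longrightarrow> c t i \<le> 1 + \<mu> t * deriv (deriv (U i)) z"
    and c_pos: "\<And>t i. 0 < c t i"
  shows "ennreal (exp (2 / real (CARD('n) + CARD('m)) *
            ((\<Sum>i\<in>UNIV. \<Sum>t<k. ln (c t i)) - real k * average_rate Q k - ln (4 * C\<^sup>2))) / 64)
         \<le> (\<integral>\<^sup>+\<omega>. ennreal ((norm ((X k \<omega>, L k \<omega>) - (xs, ls)))\<^sup>2) \<partial>M)"
proof -
  interpret prob_space M by (rule prob)
  have GM: "G \<subseteq> space M" by (rule sets.sets_into_space) fact
  define d where "d = real (CARD('n) + CARD('m))"
  have "0 < d" by (simp add: d_def add_pos_pos)
  define J where "J i = (\<Prod>t<k. c t i)" for i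
  have J_pos: "0 < J i" for i using c_pos by (simp add: J_def prod_pos)
  define w where "w = (\<Sum>i\<in>UNIV. \<Sum>t<k. ln (c t i)) - real k * average_rate Q k - ln (4 * C\<^sup>2)"
  \<comment> \<open>The solution of the equation that sets the probability bound to 1/4.\<close>
  define r where "r = exp (w / d) / 4"
  have "0 < r" by (simp add: r_def)
  define Z where "Z \<omega> = norm ((X k \<omega>, L k \<omega>) - (xs, ls))" for \<omega>
  have Z_measurable [measurable]: "Z \<in> borel_measurable M"
    unfolding Z_def by simp
  define H where "H = {\<omega>\<in>G. Z \<omega> \<le> r}"
  have "H = G \<inter> {\<omega>\<in>space M. Z \<omega> \<le> r}" using GM by (auto simp: H_def)
  then have [measurable]: "H \<in> sets M" by simp
  have close: "\<bar>X k \<omega> $ i - xs $ i\<bar> \<le> r" "\<bar>L k \<omega> $ j - ls $ j\<bar> \<le> r" if "\<omega> \<in> H" for \<omega> i j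
  proof -
    have "norm (X k \<omega> - xs) \<le> r" "norm (L k \<omega> - ls) \<le> r"
      using that norm_fst_le[of "X k \<omega> - xs" "L k \<omega> - ls"] norm_snd_le[of "L k \<omega> - ls" "X k \<omega> - xs"]
      by (auto simp: H_def Z_def)
    then show "\<bar>X k \<omega> $ i - xs $ i\<bar> \<le> r" "\<bar>L k \<omega> $ j - ls $ j\<bar> \<le> r"
      using component_le_norm_cart[of "X k \<omega> - xs" i] component_le_norm_cart[of "L k \<omega> - ls" j] by simp_all
  qed
  have "prob H \<le> real (card (symbol_profiles Q k)) *
      (C * (\<Prod>i\<in>UNIV. 2 * (2 * r / J i)) * (C * (\<Prod>j\<in>(UNIV::'n set). 2 * (2 * r))))"
  proof (rule prob_le_card_cells[OF prob px pl indep, where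
        \<sigma> = "\<lambda>\<omega>. run_symbols Q k (\<lambda>n. X n \<omega>) (\<lambda>n. L n \<omega>)"])
    fix \<omega> \<omega>' i
    assume *: "\<omega> \<in> H" "\<omega>' \<in> H"
      "run_symbols Q k (\<lambda>n. X n \<omega>) (\<lambda>n. L n \<omega>) = run_symbols Q k (\<lambda>n. X n \<omega>') (\<lambda>n. L n \<omega>')"
    then have G: "\<omega> \<in> G" "\<omega>' \<in> G" by (auto simp: H_def)
    have "J i * \<bar>X 0 \<omega> $ i - X 0 \<omega>' $ i\<bar> \<le> \<bar>X k \<omega> $ i - X k \<omega>' $ i\<bar>"
      unfolding J_def
      by (rule primal_runs_expand[where S = "\<lambda>t. S t i", OF run run *(3) C2])
        (use G GM S slope c_pos in \<open>auto simp: less_imp_le\<close>)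
    also have "\<dots> \<le> 2 * r" using close(1)[OF *(1), of i] close(1)[OF *(2), of i] by linarith
    finally show "\<bar>X 0 \<omega> $ i - X 0 \<omega>' $ i\<bar> \<le> 2 * r / J i"
      using J_pos[of i] by (simp add: pos_le_divide_eq mult.commute)
  next
    fix \<omega> \<omega>' j
    assume *: "\<omega> \<in> H" "\<omega>' \<in> H"
      "run_symbols Q k (\<lambda>n. X n \<omega>) (\<lambda>n. L n \<omega>) = run_symbols Q k (\<lambda>n. X n \<omega>') (\<lambda>n. L n \<omega>')"
    then have "L k \<omega> $ j - L k \<omega>' $ j = L 0 \<omega> $ j - L 0 \<omega>' $ j"
      using GM by (intro dual_runs_translate[OF run run *(3)]) (auto simp: H_def)
    then show "\<bar>L 0 \<omega> $ j - L 0 \<omega>' $ j\<bar> \<le> 2 * r"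
      using close(2)[OF *(1), of j] close(2)[OF *(2), of j] by linarith
  qed (use C J_pos \<open>0 < r\<close> scheme in \<open>auto simp: H_def less_imp_le run_symbols_in_profiles finite_symbol_profiles\<close>)
  also have "\<dots> = exp (real k * average_rate Q k) * (C\<^sup>2 * (4 * r) ^ (CARD('n) + CARD('m)) / (\<Prod>i\<in>UNIV. J i))"
    by (simp add: card_symbol_profiles[OF scheme] prod_dividef power_add power2_eq_square ac_simps)
  also have "(4 * r) ^ (CARD('n) + CARD('m)) = exp w"
    using \<open>0 < d\<close> by (simp add: r_def d_def flip: exp_of_nat_mult)
  also have "exp w = (\<Prod>i\<in>UNIV. J i) / exp (real k * average_rate Q k) / (4 * C\<^sup>2)"
    using c_pos \<open>0 < C\<close> by (simp add: w_def exp_diff exp_sum J_def)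
  also have "exp (real k * average_rate Q k) * (C\<^sup>2 * ((\<Prod>i\<in>UNIV. J i) / exp (real k * average_rate Q k) / (4 * C\<^sup>2)) / (\<Prod>i\<in>UNIV. J i)) = 1 / 4"
    using J_pos \<open>0 < C\<close> by (simp add: less_imp_neq[symmetric])
  finally have "prob H \<le> 1 / 4" .
  then have "ennreal (r\<^sup>2 / 4) \<le> (\<integral>\<^sup>+\<omega>. ennreal ((Z \<omega>)\<^sup>2) \<partial>M)"
    using \<open>0 < r\<close> half unfolding H_def by (intro second_moment_ge[OF prob, where G = G]) auto
  moreover have "r\<^sup>2 / 4 = exp (2 / d * w) / 64"
    using exp_double[of "w / d"] by (simp add: r_def power_divide)
  ultimately show ?thesis
    by (simp add: Z_def d_def w_def)
qed

section \<open>The asymptotic bound\<close>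

lemma slope_near_optimum:
  assumes C2: "twice_continuously_differentiable f" and \<mu>: "\<mu> \<longlonglongrightarrow> \<mu>s"
    and c: "c < 1 + \<mu>s * deriv (deriv f) a"
  shows "\<exists>\<eta>>0. \<exists>K. \<forall>t\<ge>K. \<forall>z. dist z a \<le> \<eta> \<longrightarrow> c \<le> 1 + \<mu> t * deriv (deriv f) z"
proof -
  have "(deriv (deriv f) \<longlongrightarrow> deriv (deriv f) a) (nhds a)"
    using C2 by (auto simp: twice_continuously_differentiable_def continuous_on_eq_continuous_at
        isCont_def tendsto_at_iff_tendsto_nhds)
  then have "((\<lambda>tz. deriv (deriv f) (snd tz)) \<longlongrightarrow> deriv (deriv f) a) (sequentially \<times>\<^sub>F nhds a)"
    by (rule filterlim_compose) (rule filterlim_snd)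
  moreover have "((\<lambda>tz. \<mu> (fst tz)) \<longlongrightarrow> \<mu>s) (sequentially \<times>\<^sub>F nhds a)"
    using \<mu> by (rule filterlim_compose) (rule filterlim_fst)
  ultimately have "((\<lambda>tz. 1 + \<mu> (fst tz) * deriv (deriv f) (snd tz)) \<longlongrightarrow>
      1 + \<mu>s * deriv (deriv f) a) (sequentially \<times>\<^sub>F nhds a)"
    by (intro tendsto_intros)
  then have "eventually (\<lambda>tz. c < 1 + \<mu> (fst tz) * deriv (deriv f) (snd tz)) (sequentially \<times>\<^sub>F nhds a)"
    using c by (rule order_tendstoD)
  then obtain P R where P: "eventually P sequentially" and R: "eventually R (nhds a)"
    and PR: "\<And>t z. P t \<Longrightarrow> R z \<Longrightarrow> c < 1 + \<mu> t * deriv (deriv f) z"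
    unfolding eventually_prod_filter by auto
  obtain K where K: "\<And>t. t \<ge> K \<Longrightarrow> P t" using P by (auto simp: eventually_sequentially)
  obtain \<eta> where \<eta>: "0 < \<eta>" "\<And>z. dist z a < \<eta> \<Longrightarrow> R z" using R by (auto simp: eventually_nhds_metric)
  show ?thesis
  proof (intro exI[of _ "\<eta> / 2"] exI[of _ K] conjI allI impI)
    fix t z assume "K \<le> t" "dist z a \<le> \<eta> / 2"
    then show "c \<le> 1 + \<mu> t * deriv (deriv f) z"
      using PR[OF K \<eta>(2), of t z] \<eta>(1) by simp
  qed (use \<eta>(1) in simp)
qed

lemma eln_ge_ln:
  assumes "0 < e" and "ennreal e \<le> E"
  shows "ereal (ln e) \<le> eln (enn2ereal E)"
proof (cases E)
  case (real y)
  with assms have "e \<le> y" by (simp add: ennreal_le_iff)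
  then show ?thesis using real assms(1) by (simp add: eln_def)
qed (simp add: eln_def)

theorem theorem1:
  fixes A :: "real^'m::finite^'n::finite"
    and b :: "real^'n"
    and U :: "'m \<Rightarrow> real \<Rightarrow> real"
    and Umin Umax :: "'m \<Rightarrow> real"
    and \<mu> :: "nat \<Rightarrow> real" and \<mu>s :: real
    and xs :: "real^'m" and ls :: "real^'n"
    and Q :: "('m, 'n, 's, 't) quantization_scheme"
    and \<Omega> :: "'w measure"
    and X :: "nat \<Rightarrow> 'w \<Rightarrow> real^'m" and L :: "nat \<Rightarrow> 'w \<Rightarrow> real^'n"
    and px :: "real^'m \<Rightarrow> real" and pl :: "real^'n \<Rightarrow> real"
  assumes dims: "CARD('n) < CARD('m)"
    and concave: "\<And>i. concave_on UNIV (U i)"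
    and C2: "\<And>i. twice_continuously_differentiable (U i)"
    and bounds: "\<And>i z. Umin i \<le> deriv (deriv (U i)) z \<and> deriv (deriv (U i)) z \<le> Umax i"
    and Umax_neg: "\<And>i. Umax i < 0"
    and step: "\<And>k. 0 < \<mu> k \<and> \<mu> k < (MIN i. 1 / \<bar>Umin i\<bar>)"
    and step_lim: "\<mu> \<longlonglongrightarrow> \<mu>s" and step_lim_pos: "0 < \<mu>s"
    and primal: "primal_optimal U A b xs"
    and dual: "dual_optimal U A b ls"
    and prob: "prob_space \<Omega>"
    and X_rv: "\<And>k. X k \<in> borel_measurable \<Omega>"
    and L_rv: "\<And>k. L k \<in> borel_measurable \<Omega>"
    and X0_entropy: "information_space.finite_entropy \<Omega> (exp 1) lborel (X 0) px"
    and L0_entropy: "information_space.finite_entropy \<Omega> (exp 1) lborel (L 0) pl"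
    and indep: "independent_vars \<Omega> (X 0) (L 0)"
    and scheme: "valid_scheme Q"
    and run: "\<And>\<omega>. \<omega> \<in> space \<Omega> \<Longrightarrow> pd_run U A b \<mu> Q (\<lambda>k. X k \<omega>) (\<lambda>k. L k \<omega>)"
    and OA: "optimum_achieving U A b \<mu> px pl xs ls Q"
    and rate: "convergent (\<lambda>k. ereal (average_rate Q k))"
  shows "liminf (\<lambda>k. ereal (1 / real k) *
             eln (enn2ereal (\<integral>\<^sup>+ \<omega>. ennreal ((norm ((X k \<omega>, L k \<omega>) - (xs, ls)))\<^sup>2) \<partial>\<Omega>)))
         \<ge> ereal (2 / real (CARD('n) + CARD('m))) *
             ((\<Sum>i\<in>UNIV. eln (ereal (1 + \<mu>s * deriv (deriv (U i)) (xs $ i)))) - data_rate Q)"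
proof -
  interpret prob_space \<Omega> by (rule prob)
  interpret information_space \<Omega> "exp 1" by standard simp
  define f'' where "f'' i = deriv (deriv (U i)) (xs $ i)" for i
  define D where "D = real (CARD('n) + CARD('m))"
  have "0 < D" by (simp add: D_def add_pos_pos)
  define E where "E k = (\<integral>\<^sup>+ \<omega>. ennreal ((norm ((X k \<omega>, L k \<omega>) - (xs, ls)))\<^sup>2) \<partial>\<Omega>)" for k
  define term' where "term' k = ereal (1 / real k) * eln (enn2ereal (E k))" for k
  define gain where "gain = (\<Sum>i\<in>UNIV. eln (ereal (1 + \<mu>s * f'' i)))"
  have eln_finite: "eln (ereal a) \<noteq> \<infinity>" for a by (simp add: eln_def)
  then have gain_finite: "gain \<noteq> \<infinity>" by (simp add: gain_def sum_Pinfty)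
  have rate_lim: "(\<lambda>k. ereal (average_rate Q k)) \<longlonglongrightarrow> data_rate Q"
    using rate unfolding data_rate_def by (simp add: convergent_LIMSEQ_iff)
  then have "0 \<le> data_rate Q"
    by (rule LIMSEQ_le_const) (simp add: average_rate_nonneg[OF scheme])
  \<comment> \<open>If the rate is infinite or some limiting slope vanishes, the bound is minus infinity.\<close>
  have "ereal (2 / D) * (gain - data_rate Q) \<le> liminf term'"
  proof (cases "data_rate Q = \<infinity> \<or> (\<exists>i. 1 + \<mu>s * f'' i \<le> 0)")
    case True
    have "gain - data_rate Q = - \<infinity>"
    proof (cases "data_rate Q = \<infinity>")
      case True
      then show ?thesis using gain_finite by (cases gain) auto
    next
      case False
      with True obtain i where "1 + \<mu>s * f'' i \<le> 0" by blast
      then have "eln (ereal (1 + \<mu>s * f'' i)) = - \<infinity>" by (simp add: eln_def)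
      then have "gain = - \<infinity> + (\<Sum>i\<in>UNIV - {i}. eln (ereal (1 + \<mu>s * f'' i)))"
        unfolding gain_def by (subst sum.remove[of _ i]) auto
      also have "\<dots> = - \<infinity>"
        using eln_finite by (simp add: sum_Pinfty)
      finally show ?thesis
        using \<open>0 \<le> data_rate Q\<close> by (cases "data_rate Q") auto
    qed
    then show ?thesis using \<open>0 < D\<close> by simp
  next
    case False
    then have f''_pos: "0 < 1 + \<mu>s * f'' i" for i by (simp add: not_le)
    obtain R where R: "data_rate Q = ereal R"
      using False \<open>0 \<le> data_rate Q\<close> by (cases "data_rate Q") auto
    with rate_lim have R_lim: "(\<lambda>k. average_rate Q k) \<longlonglongrightarrow> R" by simp
    define g where "g = (\<Sum>i\<in>UNIV. ln (1 + \<mu>s * f'' i))"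
    have "eln (ereal (1 + \<mu>s * f'' i)) = ereal (ln (1 + \<mu>s * f'' i))" for i
      using f''_pos[of i] by (simp add: eln_def)
    then have gain: "gain = ereal g" by (simp add: gain_def g_def)
    have X0: "distributed \<Omega> lborel (X 0) (\<lambda>x. ennreal (px x))" "\<And>x. 0 \<le> px x"
      and L0: "distributed \<Omega> lborel (L 0) (\<lambda>l. ennreal (pl l))" "\<And>l. 0 \<le> pl l"
      using X0_entropy L0_entropy by (simp_all add: finite_entropy_def)
    have [measurable]: "px \<in> borel_measurable borel" "pl \<in> borel_measurable borel"
      using distributed_real_measurable[OF _ X0(1)] distributed_real_measurable[OF _ L0(1)] X0(2) L0(2)
      by simp_all
    have X_conv: "AE \<omega> in \<Omega>. (\<lambda>k. X k \<omega>) \<longlonglongrightarrow> xs"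
      using AE_density_nonzero[OF X0] AE_density_nonzero[OF L0] AE_space
    proof eventually_elim
      case (elim \<omega>)
      then show ?case
        using OA run[of \<omega>] unfolding optimum_achieving_def support_on_def by blast
    qed
    have lower: "ereal (2 / D * (g - real CARD('m) * \<delta> - R)) \<le> liminf term'" if "0 < \<delta>" for \<delta>
    proof -
      \<comment> \<open>A slope slightly below the limiting one, with a total loss in the exponent linear in \<open>\<delta>\<close>.\<close>
      define c where "c i = exp (- \<delta>) * (1 + \<mu>s * f'' i)" for i
      have c_pos: "0 < c i" for i using f''_pos by (simp add: c_def)
      have c_less: "c i < 1 + \<mu>s * f'' i" for i
        using f''_pos[of i] \<open>0 < \<delta>\<close> by (simp add: c_def)
      have "ln (c i) = ln (1 + \<mu>s * f'' i) - \<delta>" for i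
        using f''_pos[of i] by (simp add: c_def ln_mult)
      then have ln_c: "(\<Sum>i\<in>UNIV. ln (c i)) = g - real CARD('m) * \<delta>"
        by (simp add: g_def sum_subtractf)
      have "\<forall>i. \<exists>\<eta> K. 0 < \<eta> \<and> (\<forall>t\<ge>K. \<forall>z. dist z (xs $ i) \<le> \<eta> \<longrightarrow>
          c i \<le> 1 + \<mu> t * deriv (deriv (U i)) z)"
        using slope_near_optimum[OF C2 step_lim c_less[unfolded f''_def]] by blast
      then obtain \<eta> K where \<eta>K: "\<And>i. 0 < \<eta> i"
        "\<And>i t z. K i \<le> t \<Longrightarrow> dist z (xs $ i) \<le> \<eta> i \<Longrightarrow> c i \<le> 1 + \<mu> t * deriv (deriv (U i)) z"
        by metis
      define \<eta>0 where "\<eta>0 = (MIN i. \<eta> i)"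
      have "0 < \<eta>0" using \<eta>K(1) by (simp add: \<eta>0_def)
      have \<eta>0_le: "\<eta>0 \<le> \<eta> i" for i by (simp add: \<eta>0_def)
      define good where "good n = {\<omega>\<in>space \<Omega>. px (X 0 \<omega>) \<le> real n \<and> pl (L 0 \<omega>) \<le> real n \<and>
          (\<forall>t\<ge>n. dist (X t \<omega>) xs \<le> \<eta>0)}" for n
      have "eventually (\<lambda>n. 1 / 2 \<le> prob (good n)) sequentially"
        unfolding good_def using X_rv L_rv
        by (intro eventually_prob_bounded_and_close[OF prob _ _ _ X_conv \<open>0 < \<eta>0\<close>]) auto
      \<comment> \<open>One index \<open>n\<close> serves as time threshold and as density bound; the successor makes it positive.\<close>
      then have "eventually (\<lambda>n. Suc (MAX i. K i) \<le> n \<and> 1 / 2 \<le> prob (good n)) sequentially"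
        by (intro eventually_conj eventually_ge_at_top)
      from eventually_happens'[OF sequentially_bot this]
      obtain n where n: "Suc (MAX i. K i) \<le> n" and half: "1 / 2 \<le> prob (good n)" by blast
      define G where "G = good n"
      have K_le: "K i \<le> n" for i
      proof -
        have "K i \<le> (MAX i. K i)" by (intro Max_ge) auto
        with n show ?thesis by linarith
      qed
      \<comment> \<open>Before time \<open>n\<close> nothing is known about the position of the iterates, and the global bound
        on the curvature has to do; these finitely many factors vanish in the exponent.\<close>
      define S where "S t i = (if t < n then UNIV else cball (xs $ i) \<eta>0)" for t i
      define a where "a t i = (if t < n then 1 + \<mu> t * Umin i else c i)" for t i
      have Umin_pos: "0 < 1 + \<mu> t * Umin i" for t i
      proof -
        have "Umin i < 0" using bounds[of i 0] Umax_neg[of i] by linarith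
        moreover have "\<mu> t < 1 / \<bar>Umin i\<bar>"
        proof -
          have "(MIN i. 1 / \<bar>Umin i\<bar>) \<le> 1 / \<bar>Umin i\<bar>" by (intro Min_le) auto
          with step[of t] show ?thesis by linarith
        qed
        ultimately show ?thesis by (simp add: field_simps)
      qed
      have a_pos: "0 < a t i" for t i using Umin_pos c_pos by (simp add: a_def)
      have slope: "a t i \<le> 1 + \<mu> t * deriv (deriv (U i)) z" if "z \<in> S t i" for t i z
      proof (cases "t < n")
        case True
        then show ?thesis
          using bounds[of i z] step[of t] by (simp add: a_def mult_left_mono)
      next
        case False
        then have "dist z (xs $ i) \<le> \<eta> i"
          using that \<eta>0_le[of i] by (simp add: S_def dist_commute)
        with False show ?thesis
          using \<eta>K(2)[of i t z] K_le[of i] by (simp add: a_def)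
      qed
      have in_S: "X t \<omega> $ i \<in> S t i" if "\<omega> \<in> G" for \<omega> t i
        using that dist_vec_nth_le[of xs i "X t \<omega>"]
        by (auto simp: G_def good_def S_def dist_commute intro: order_trans)
      have G_event [measurable]: "G \<in> events"
        unfolding G_def good_def using X_rv L_rv by measurable
      define W where "W = (\<Sum>i\<in>UNIV. \<Sum>t<n. ln (a t i) - ln (c i)) - ln (4 * (real n)\<^sup>2)"
      have sum_ln_a: "(\<Sum>t<k. ln (a t i)) = (\<Sum>t<n. ln (a t i) - ln (c i)) + real k * ln (c i)"
        if "n \<le> k" for k i
        using that
      proof (induction k rule: dec_induct)
        case base
        show ?case by (simp add: sum_subtractf)
      next
        case (step k)
        then show ?case by (simp add: a_def algebra_simps)
      qed
      have error: "ennreal (exp (2 / D * (W + real k * (g - real CARD('m) * \<delta> - average_rate Q k))) / 64) \<le> E k"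
        if "n \<le> k" for k
      proof -
        have "(\<Sum>i\<in>UNIV. \<Sum>t<k. ln (a t i)) - real k * average_rate Q k - ln (4 * (real n)\<^sup>2) =
            W + real k * (g - real CARD('m) * \<delta> - average_rate Q k)"
          using that
          by (simp add: sum_ln_a sum.distrib W_def right_diff_distrib flip: ln_c sum_distrib_left)
        moreover have "ennreal (exp (2 / D * ((\<Sum>i\<in>UNIV. \<Sum>t<k. ln (a t i)) -
            real k * average_rate Q k - ln (4 * (real n)\<^sup>2))) / 64) \<le> E k"
          unfolding E_def D_def
          by (rule mean_square_error_ge[OF prob X_rv L_rv X0(1) _ L0(1) _ indep scheme run C2
                G_event _ _ _ in_S _ slope a_pos])
            (use n half in \<open>auto simp: G_def good_def S_def\<close>)
        ultimately show ?thesis by simp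
      qed
      define v where "v k = 2 / D * (g - real CARD('m) * \<delta> - average_rate Q k) +
          (2 / D * W - ln 64) / real k" for k
      have "v \<longlonglongrightarrow> 2 / D * (g - real CARD('m) * \<delta> - R) + 0"
        unfolding v_def by (intro tendsto_intros R_lim lim_const_over_n)
      then have "liminf (\<lambda>k. ereal (v k)) = ereal (2 / D * (g - real CARD('m) * \<delta> - R))"
        by (intro lim_imp_Liminf) simp_all
      moreover have "liminf (\<lambda>k. ereal (v k)) \<le> liminf term'"
      proof (rule Liminf_mono)
        show "eventually (\<lambda>k. ereal (v k) \<le> term' k) sequentially"
          using eventually_ge_at_top[of n]
        proof eventually_elim
          case (elim k)
          have "0 < k" using elim n by simp
          define w where "w = W + real k * (g - real CARD('m) * \<delta> - average_rate Q k)"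
          have "ereal (2 / D * w - ln 64) \<le> eln (enn2ereal (E k))"
            using eln_ge_ln[OF _ error[OF elim]] by (simp add: ln_div w_def)
          then have "ereal (1 / real k) * ereal (2 / D * w - ln 64) \<le> term' k"
            unfolding term'_def by (rule ereal_mult_left_mono) simp
          moreover have "1 / real k * (2 / D * w - ln 64) = v k"
            using \<open>0 < k\<close> \<open>0 < D\<close> by (simp add: v_def w_def field_simps)
          ultimately show ?case by simp
        qed
      qed
      ultimately show ?thesis by simp
    qed
    have "((\<lambda>\<delta>. ereal (2 / D * (g - real CARD('m) * \<delta> - R))) \<longlongrightarrow>
        ereal (2 / D * (g - real CARD('m) * 0 - R))) (at_right 0)"
      by (intro tendsto_intros)
    then have "ereal (2 / D * (g - real CARD('m) * 0 - R)) \<le> liminf term'"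
      by (rule tendsto_upperbound)
        (use lower in \<open>auto intro: eventually_mono[OF eventually_at_right_less]\<close>)
    then show ?thesis by (simp add: gain R)
  qed
  then show ?thesis
    unfolding term'_def[abs_def] E_def gain_def f''_def D_def .
qed

end
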